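(* There is an absolute constant $C$ such that the following holds. For any finite graph $G$ and any combinatorial $k$-wiring $f: G \to \mathrm{Cay}(\mathbb{H},\{x,y\})$ such that $fu \neq fv$ whenever $u,v$ are adjacent vertices of $G$, there exists a combinatorial embedding $\tilde f: G \to \mathrm{Cay}(\mathbb{H},\{x,y,z\})$ satisfying $$\mathrm{diam}(\tilde f) \leq C k \cdot \mathrm{diam}(f) \quad\text{and}\quad \mathrm{vol}(\tilde f) \leq C k^2 \cdot \mathrm{vol}(f).$$
   Context: Graphs are undirected, without loops or multiple edges; $VG$, $EG$ denote the vertex and edge sets of a graph $G$. Here $k$ is a natural number, and the constant $C$ does not depend on $G$, $f$ or $k$. $\mathbb{H}$ is the discrete Heisenberg group of $3\times 3$ upper-triangular integer matrices with ones on the diagonal, identified with $\mathbb{Z}^3$ with multiplication $(a,b,c)\cdot(a',b',c') = (a+a',\, b+b',\, c+c'+ab')$, and $x=(1,0,0)$, $y=(0,1,0)$, $z=(0,0,1)$. Both $\{x,y\}$ and $\{x,y,z\}$ generate $\mathbb{H}$. Cayley graph: for a group $\Gamma$ with finite generating set $S$, $\mathrm{Cay}(\Gamma,S)$ is the graph with vertex set $\Gamma$ and an edge between $g$ and $h$ if and only if $g^{-1}h \in S\cup S^{-1}$. A walk in a graph $Y$ is a finite sequence of vertices in which consecutive vertices are adjacent. Combinatorial wiring: for graphs $G, Y$, a combinatorial wiring $f: G\to Y$ assigns to each vertex $v \in VG$ a vertex $fv \in VY$ and to each edge $e=\{u,v\}\in EG$ a walk $f_e$ in $Y$ (called a road)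 with endpoints $fu, fv$. The load of $y \in VY$ is $\mathrm{load}_f(y) = \max\big(|\{e\in EG : y \in f_e\}|,\ |\{v \in VG : fv=y\}|\big)$. The wiring $f$ is a combinatorial $k$-wiring if $\sup_{y\in VY}\mathrm{load}_f(y) \leq k$. The image of $f$ is the set of all vertices of $Y$ that are in $f(VG)$ or on some road of $f$; the volume $\mathrm{vol}(f)$ and diameter $\mathrm{diam}(f)$ are the cardinality of the image and its diameter in the graph metric of the target graph $Y$. Combinatorial embedding: a combinatorial wiring $f: G\to Y$ such that (1) $f|_{VG}$ is injective; (2) for any two non-adjacent edges $e,t\in EG$ (no common vertex), $f_e\cap f_t=\emptyset$ (as sets of vertices); (3) for any edge $e \in EG$ and any vertex $v\notin e$, $fv \notin f_e$.
   Formalization: The diameter bound is asserted only when G has at most one vertex or diam(f) > 0, since it fails for two or more vertices all sent to one point; vertices of the finite graph G are taken to be natural numbers. *)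

theory Defs
  imports Complex_Main "HOL-Algebra.Group"
begin

section \<open>Graphs, walks, distance\<close>

record 'a graph =
  verts :: "'a set"
  edges :: "'a set set"

definition simple_graph :: "'a graph \<Rightarrow> bool" where
  "simple_graph G \<longleftrightarrow> (\<forall>e\<in>edges G. e \<subseteq> verts G \<and> card e = 2)"

text \<open>A walk is a nonempty list of vertices; its length is the number of steps,
  i.e. one less than the length of the list.\<close>

definition walk :: "'a graph \<Rightarrow> 'a list \<Rightarrow> bool" where
  "walk Y w \<longleftrightarrow> w \<noteq> [] \<and> set w \<subseteq> verts Y \<and> successively (\<lambda>u v. {u, v} \<in> edges Y) w"

text \<open>Meaningful only for vertices joined by a walk; the Cayley graphs below are connected
  (lemmas \<open>heis_xy_connected\<close> and \<open>heis_xyz_connected\<close>).\<close>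

definition graph_dist :: "'a graph \<Rightarrow> 'a \<Rightarrow> 'a \<Rightarrow> nat" where
  "graph_dist Y u v = (LEAST n. \<exists>w. walk Y w \<and> hd w = u \<and> last w = v \<and> length w = Suc n)"

text \<open>Used for finite sets only. The diameter of the empty set is \<open>0\<close>,
  because \<open>Sup {} = 0\<close> on the natural numbers.\<close>

definition graph_diam :: "'a graph \<Rightarrow> 'a set \<Rightarrow> nat" where
  "graph_diam Y A = (SUP p\<in>A \<times> A. graph_dist Y (fst p) (snd p))"


section \<open>Combinatorial wirings and embeddings\<close>

record ('a, 'b) wiring =
  vmap :: "'a \<Rightarrow> 'b"
  road :: "'a set \<Rightarrow> 'b list"

text \<open>Edges are undirected, so a road may be listed from either of its ends: its endpoints
  are required to be those prescribed by the edge as a set.\<close>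

definition combinatorial_wiring :: "'a graph \<Rightarrow> 'b graph \<Rightarrow> ('a, 'b) wiring \<Rightarrow> bool" where
  "combinatorial_wiring G Y f \<longleftrightarrow>
     (\<forall>v\<in>verts G. vmap f v \<in> verts Y) \<and>
     (\<forall>e\<in>edges G. walk Y (road f e) \<and> {hd (road f e), last (road f e)} = vmap f ` e)"

definition load :: "'a graph \<Rightarrow> ('a, 'b) wiring \<Rightarrow> 'b \<Rightarrow> nat" where
  "load G f y = max (card {e \<in> edges G. y \<in> set (road f e)}) (card {v \<in> verts G. vmap f v = y})"

definition combinatorial_k_wiring ::
    "nat \<Rightarrow> 'a graph \<Rightarrow> 'b graph \<Rightarrow> ('a, 'b) wiring \<Rightarrow> bool" where
  "combinatorial_k_wiring k G Y f \<longleftrightarrow>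
     combinatorial_wiring G Y f \<and> (\<forall>y\<in>verts Y. load G f y \<le> k)"

definition wiring_image :: "'a graph \<Rightarrow> ('a, 'b) wiring \<Rightarrow> 'b set" where
  "wiring_image G f = vmap f ` verts G \<union> (\<Union>e\<in>edges G. set (road f e))"

definition wiring_vol :: "'a graph \<Rightarrow> ('a, 'b) wiring \<Rightarrow> nat" where
  "wiring_vol G f = card (wiring_image G f)"

definition wiring_diam :: "'a graph \<Rightarrow> 'b graph \<Rightarrow> ('a, 'b) wiring \<Rightarrow> nat" where
  "wiring_diam G Y f = graph_diam Y (wiring_image G f)"

definition combinatorial_embedding :: "'a graph \<Rightarrow> 'b graph \<Rightarrow> ('a, 'b) wiring \<Rightarrow> bool" where
  "combinatorial_embedding G Y f \<longleftrightarrow>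
     combinatorial_wiring G Y f \<and>
     inj_on (vmap f) (verts G) \<and>
     (\<forall>e\<in>edges G. \<forall>t\<in>edges G. e \<inter> t = {} \<longrightarrow> set (road f e) \<inter> set (road f t) = {}) \<and>
     (\<forall>e\<in>edges G. \<forall>v\<in>verts G. v \<notin> e \<longrightarrow> vmap f v \<notin> set (road f e))"


section \<open>Cayley graphs and the discrete Heisenberg group\<close>

definition cayley_graph :: "('g, 'm) monoid_scheme \<Rightarrow> 'g set \<Rightarrow> 'g graph" where
  "cayley_graph \<Gamma> S =
     \<lparr>verts = carrier \<Gamma>,
      edges = {{g, h} | g h. g \<in> carrier \<Gamma> \<and> h \<in> carrier \<Gamma> \<and>
                 inv\<^bsub>\<Gamma>\<^esub> g \<otimes>\<^bsub>\<Gamma>\<^esub> h \<in> S \<union> (\<lambda>s. inv\<^bsub>\<Gamma>\<^esub> s) ` S}\<rparr>"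

type_synonym heis = "int \<times> int \<times> int"

definition heis_group :: "heis monoid" where
  "heis_group = \<lparr>carrier = UNIV,
     mult = (\<lambda>(a, b, c) (a', b', c'). (a + a', b + b', c + c' + a * b')),
     one = (0, 0, 0)\<rparr>"

definition heis_x :: heis where "heis_x = (1, 0, 0)"
definition heis_y :: heis where "heis_y = (0, 1, 0)"
definition heis_z :: heis where "heis_z = (0, 0, 1)"

definition heis_xy :: "heis graph" where
  "heis_xy = cayley_graph heis_group {heis_x, heis_y}"

definition heis_xyz :: "heis graph" where
  "heis_xyz = cayley_graph heis_group {heis_x, heis_y, heis_z}"


section \<open>The Cayley graphs are simple and connected\<close>

lemma heis_mult [simp]:
  "(a, b, c) \<otimes>\<^bsub>heis_group\<^esub> (a', b', c') = (a + a', b + b', c + c' + a * b')"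
  by (simp add: heis_group_def)

lemma heis_one [simp]: "\<one>\<^bsub>heis_group\<^esub> = (0, 0, 0)"
  by (simp add: heis_group_def)

lemma heis_carrier [simp]: "carrier heis_group = UNIV"
  by (simp add: heis_group_def)

lemma group_heis: "group heis_group"
proof (rule groupI)
  fix g :: heis
  assume "g \<in> carrier heis_group"
  obtain a b c where g: "g = (a, b, c)" by (cases g)
  have "(- a, - b, a * b - c) \<otimes>\<^bsub>heis_group\<^esub> g = \<one>\<^bsub>heis_group\<^esub>"
    by (simp add: g)
  then show "\<exists>h\<in>carrier heis_group. h \<otimes>\<^bsub>heis_group\<^esub> g = \<one>\<^bsub>heis_group\<^esub>"
    by (metis UNIV_I heis_carrier)
qed (auto simp: algebra_simps)

lemma heis_inv [simp]: "inv\<^bsub>heis_group\<^esub> (a, b, c) = (- a, - b, a * b - c)"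
  by (rule group.inv_equality[OF group_heis]) auto

lemma cayley_graph_simple:
  assumes "group \<Gamma>" and "S \<subseteq> carrier \<Gamma>" and "\<one>\<^bsub>\<Gamma>\<^esub> \<notin> S"
  shows "simple_graph (cayley_graph \<Gamma> S)"
proof -
  interpret group \<Gamma> by fact
  have "g \<noteq> h" if "g \<in> carrier \<Gamma>" "inv\<^bsub>\<Gamma>\<^esub> g \<otimes>\<^bsub>\<Gamma>\<^esub> h \<in> S \<union> (\<lambda>s. inv\<^bsub>\<Gamma>\<^esub> s) ` S" for g h
  proof
    assume "g = h"
    with that have "\<one>\<^bsub>\<Gamma>\<^esub> \<in> S \<union> (\<lambda>s. inv\<^bsub>\<Gamma>\<^esub> s) ` S" by simp
    then obtain s where "s \<in> S" "\<one>\<^bsub>\<Gamma>\<^esub> = inv\<^bsub>\<Gamma>\<^esub> s" using assms(3) by auto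
    then have "s = \<one>\<^bsub>\<Gamma>\<^esub>" using assms(2) by (metis inv_one inv_inv subsetD)
    with \<open>s \<in> S\<close> assms(3) show False by simp
  qed
  then show ?thesis
    by (fastforce simp: simple_graph_def cayley_graph_def card_2_iff)
qed

lemma heis_xy_simple: "simple_graph heis_xy"
  unfolding heis_xy_def
  by (rule cayley_graph_simple[OF group_heis]) (auto simp: heis_x_def heis_y_def)

lemma heis_xyz_simple: "simple_graph heis_xyz"
  unfolding heis_xyz_def
  by (rule cayley_graph_simple[OF group_heis]) (auto simp: heis_x_def heis_y_def heis_z_def)

lemma verts_heis_xy [simp]: "verts heis_xy = UNIV"
  by (simp add: heis_xy_def cayley_graph_def)

lemma verts_heis_xyz [simp]: "verts heis_xyz = UNIV"
  by (simp add: heis_xyz_def cayley_graph_def)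

lemma heis_xy_edges_subset: "edges heis_xy \<subseteq> edges heis_xyz"
  unfolding heis_xy_def heis_xyz_def cayley_graph_def graph.simps by blast

lemma heis_xy_edgeI:
  "{(a, b, c), (a + 1, b, c)} \<in> edges heis_xy"
  "{(a, b, c), (a, b + 1, c + a)} \<in> edges heis_xy"
proof -
  have "{g, h} \<in> edges heis_xy"
    if "inv\<^bsub>heis_group\<^esub> g \<otimes>\<^bsub>heis_group\<^esub> h \<in> {heis_x, heis_y}" for g h
    using that unfolding heis_xy_def cayley_graph_def graph.simps heis_carrier by blast
  from this[of "(a, b, c)" "(a + 1, b, c)"] this[of "(a, b, c)" "(a, b + 1, c + a)"]
  show "{(a, b, c), (a + 1, b, c)} \<in> edges heis_xy"
    "{(a, b, c), (a, b + 1, c + a)} \<in> edges heis_xy"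
    by (simp_all add: heis_x_def heis_y_def algebra_simps)
qed

lemma heis_xy_connected: "\<exists>w. walk heis_xy w \<and> hd w = g \<and> last w = h"
proof -
  define R where "R = (\<lambda>g h. \<exists>w. walk heis_xy w \<and> hd w = g \<and> last w = h)"
  have refl: "R g g" for g
    unfolding R_def by (rule exI[of _ "[g]"]) (simp add: walk_def)
  have edge: "R g h" if "{g, h} \<in> edges heis_xy" for g h
    unfolding R_def by (rule exI[of _ "[g, h]"]) (use that in \<open>simp add: walk_def\<close>)
  have trans: "R g j" if "R g h" "R h j" for g h j
  proof -
    from that obtain v w where v: "walk heis_xy v" "hd v = g" "last v = h"
      and w: "walk heis_xy w" "hd w = h" "last w = j"
      unfolding R_def by blast
    obtain w' where w': "w = h # w'" using w by (cases w) (auto simp: walk_def)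
    have "walk heis_xy (v @ w')" "hd (v @ w') = g" "last (v @ w') = j"
      using v w unfolding w'
      by (auto simp: walk_def successively_append_iff successively_Cons)
    then show ?thesis unfolding R_def by blast
  qed
  have sym: "R h g" if "R g h" for g h
  proof -
    from that obtain w where "walk heis_xy w" "hd w = g" "last w = h"
      unfolding R_def by blast
    then have "walk heis_xy (rev w)" "hd (rev w) = h" "last (rev w) = g"
      by (auto simp: walk_def hd_rev last_rev insert_commute)
    then show ?thesis unfolding R_def by blast
  qed
  have x_nat: "R (a, b, c) (a + int n, b, c)" for a b c n
  proof (induction n)
    case (Suc n)
    then show ?case
      using trans edge[OF heis_xy_edgeI(1)[of "a + int n" b c]] by (simp add: algebra_simps)
  qed (simp add: refl)
  have y_nat: "R (a, b, c) (a, b + int n, c + a * int n)" for a b c n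
  proof (induction n)
    case (Suc n)
    then show ?case
      using trans edge[OF heis_xy_edgeI(2)[of a "b + int n" "c + a * int n"]]
      by (simp add: algebra_simps)
  qed (simp add: refl)
  have x: "R (a, b, c) (a', b, c)" for a a' b c
  proof (cases "a \<le> a'")
    case True
    then show ?thesis using x_nat[of a b c "nat (a' - a)"] by simp
  next
    case False
    then show ?thesis using sym[OF x_nat[of a' b c "nat (a - a')"]] by simp
  qed
  have y: "R (a, b, c) (a, b + m, c + a * m)" for a b c m
  proof (cases "m \<ge> 0")
    case True
    then show ?thesis using y_nat[of a b c "nat m"] by simp
  next
    case False
    then show ?thesis using sym[OF y_nat[of a "b + m" "c + a * m" "nat (- m)"]] by simp
  qed
  have origin: "R (a, b, c) (0, 0, 0)" for a b c
  proof -
    have 1: "R (a, b, c) (0, b, c)" by (rule x)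
    have 2: "R (0, b, c) (0, 0, c)" using y[of 0 b c "- b"] by simp
    have 3: "R (0, 0, c) (1, 0, c)" by (rule x)
    have 4: "R (1, 0, c) (1, - c, 0)" using y[of 1 0 c "- c"] by simp
    have 5: "R (1, - c, 0) (0, - c, 0)" by (rule x)
    have 6: "R (0, - c, 0) (0, 0, 0)" using y[of 0 "- c" 0 c] by simp
    show ?thesis using 1 2 3 4 5 6 trans by blast
  qed
  have "R g h"
    using trans[OF origin sym[OF origin]] by (cases g, cases h) auto
  then show ?thesis unfolding R_def .
qed

lemma heis_xyz_connected: "\<exists>w. walk heis_xyz w \<and> hd w = g \<and> last w = h"
proof -
  obtain w where "walk heis_xy w" "hd w = g" "last w = h"
    using heis_xy_connected by blast
  moreover from this have "walk heis_xyz w"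
    using heis_xy_edges_subset by (auto simp: walk_def elim!: successively_mono)
  ultimately show ?thesis by blast
qed

end

theory Submission
  imports Defs
begin

text \<open>
  Replace every element \<open>g\<close> by \<open>K = 2k\<close> pairwise disjoint connected sets (blobs), each of size
  \<open>O(K)\<close>, such that every blob at \<open>g\<close> touches every blob at every \<open>xy\<close>-neighbour of \<open>g\<close>.
  An edge of \<open>G\<close> whose road passes through \<open>g\<close> gets its own blob at \<open>g\<close>, and so does every vertex
  mapped to \<open>g\<close>; the load bound says that \<open>k + k\<close> blobs suffice. The new road of an edge runs inside
  the union of its blobs and the blobs of its two ends. Since the ends of an edge have distinct
  images, its road has at least one step, so the blobs of the ends are attached through
  neighbouring group elements and need not touch the other blobs at the same element.

  The blobs at \<open>g = (a, b, c)\<close> are placed around the image \<open>(N a, N b, N\<^sup>2 c)\<close> of \<open>g\<close> under the dilation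
  by \<open>N = K + 3\<close>. Blob number \<open>i\<close> consists of rays at height \<open>2i\<close> in directions \<open>x\<close> and \<open>y\<close>, rays at
  height \<open>2i + 1\<close> in directions \<open>- x\<close> and \<open>- y\<close>, and two vertical columns standing one step beside
  the forward rays at distance \<open>i + 2\<close>. A column reaches all odd heights up to \<open>2K - 1\<close>, so it meets
  all backward rays of the next group element.
\<close>

section \<open>Reachability inside a set of vertices\<close>

text \<open>Confinement to \<open>A\<close> serves the disjointness of roads, the bound
  \<open>n\<close> the diameter estimate. An upper bound instead of an exact length makes the
  relation monotone.\<close>

definition reach :: "'a graph \<Rightarrow> 'a set \<Rightarrow> nat \<Rightarrow> 'a \<Rightarrow> 'a \<Rightarrow> bool" where
  "reach Y A n u v \<longleftrightarrow>
     (\<exists>w. walk Y w \<and> set w \<subseteq> A \<and> hd w = u \<and> last w = v \<and> length w \<le> Suc n)"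

lemma reach_refl: "u \<in> verts Y \<Longrightarrow> u \<in> A \<Longrightarrow> reach Y A 0 u u"
  unfolding reach_def by (rule exI[of _ "[u]"]) (simp add: walk_def)

lemma reach_edge:
  "{u, v} \<in> edges Y \<Longrightarrow> u \<in> verts Y \<Longrightarrow> v \<in> verts Y \<Longrightarrow> u \<in> A \<Longrightarrow> v \<in> A \<Longrightarrow> reach Y A 1 u v"
  unfolding reach_def by (rule exI[of _ "[u, v]"]) (simp add: walk_def)

lemma reach_mono: "reach Y A m u v \<Longrightarrow> A \<subseteq> B \<Longrightarrow> m \<le> n \<Longrightarrow> reach Y B n u v"
  unfolding reach_def using le_trans subset_trans Suc_le_mono by metis

lemma reach_sym: "reach Y A n u v \<Longrightarrow> reach Y A n v u"
  unfolding reach_def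
proof (elim exE conjE)
  fix w
  assume "walk Y w" "set w \<subseteq> A" "hd w = u" "last w = v" "length w \<le> Suc n"
  then show "\<exists>w. walk Y w \<and> set w \<subseteq> A \<and> hd w = v \<and> last w = u \<and> length w \<le> Suc n"
    by (intro exI[of _ "rev w"]) (auto simp: walk_def hd_rev last_rev insert_commute)
qed

lemma reach_trans:
  assumes "reach Y A m u v" "reach Y A n v w"
  shows "reach Y A (m + n) u w"
proof -
  from assms obtain p q where p: "walk Y p" "set p \<subseteq> A" "hd p = u" "last p = v" "length p \<le> Suc m"
    and q: "walk Y q" "set q \<subseteq> A" "hd q = v" "last q = w" "length q \<le> Suc n"
    unfolding reach_def by blast
  obtain q' where q': "q = v # q'" using q by (cases q) (auto simp: walk_def)
  have "walk Y (p @ q')" "set (p @ q') \<subseteq> A" "hd (p @ q') = u" "last (p @ q') = w"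
    "length (p @ q') \<le> Suc (m + n)"
    using p q unfolding q'
    by (auto simp: walk_def successively_append_iff successively_Cons)
  then show ?thesis unfolding reach_def by blast
qed

lemma reach_line:
  fixes h :: "int \<Rightarrow> 'a"
  assumes "l \<le> u"
    and "\<And>t. l \<le> t \<Longrightarrow> t < u \<Longrightarrow> {h t, h (t + 1)} \<in> edges Y"
    and "\<And>t. l \<le> t \<Longrightarrow> t \<le> u \<Longrightarrow> h t \<in> A \<and> h t \<in> verts Y"
  shows "reach Y A (nat (u - l)) (h l) (h u)"
  using assms
proof (induction u rule: int_ge_induct)
  case base
  then show ?case by (simp add: reach_refl)
next
  case (step u)
  have "reach Y A (nat (u - l)) (h l) (h u)" using step by simp
  moreover have "reach Y A 1 (h u) (h (u + 1))" using step by (intro reach_edge) auto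
  ultimately have "reach Y A (nat (u - l) + 1) (h l) (h (u + 1))" by (rule reach_trans)
  moreover have "nat (u - l) + 1 = nat (u + 1 - l)" using step(1) by simp
  ultimately show ?case by metis
qed

section \<open>Distance and diameter bounds from walks\<close>

lemma reach_imp_graph_dist_le:
  assumes "reach Y A n u v"
  shows "graph_dist Y u v \<le> n"
proof -
  obtain w where w: "walk Y w" "hd w = u" "last w = v" "length w \<le> Suc n"
    using assms unfolding reach_def by blast
  have "length w = Suc (length w - 1)" using w(1) by (cases w) (auto simp: walk_def)
  then have "graph_dist Y u v \<le> length w - 1"
    unfolding graph_dist_def using w by (intro Least_le) blast
  then show ?thesis using w(4) by simp
qed

lemma graph_dist_walk:
  assumes "walk Y w" "hd w = u" "last w = v"
  shows "\<exists>w. walk Y w \<and> hd w = u \<and> last w = v \<and> length w = Suc (graph_dist Y u v)"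
proof -
  have "length w = Suc (length w - 1)" using assms(1) by (cases w) (auto simp: walk_def)
  then have "\<exists>n. \<exists>w. walk Y w \<and> hd w = u \<and> last w = v \<and> length w = Suc n"
    using assms by blast
  then show ?thesis unfolding graph_dist_def by (rule LeastI_ex)
qed

lemma graph_dist_le_diam:
  assumes "finite A" "u \<in> A" "v \<in> A"
  shows "graph_dist Y u v \<le> graph_diam Y A"
proof -
  have "graph_dist Y (fst (u, v)) (snd (u, v)) \<le> graph_diam Y A"
    unfolding graph_diam_def by (rule cSUP_upper) (use assms in auto)
  then show ?thesis by simp
qed

lemma graph_diam_le:
  assumes "\<And>u v. u \<in> A \<Longrightarrow> v \<in> A \<Longrightarrow> graph_dist Y u v \<le> n"
  shows "graph_diam Y A \<le> n"
proof (cases "A = {}")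
  case True
  then show ?thesis by (simp add: graph_diam_def)
next
  case False
  then show ?thesis unfolding graph_diam_def by (intro cSUP_least) (use assms in auto)
qed

section \<open>Blobs\<close>

lemma heis_xyz_edgeI:
  "{(a, b, c), (a + 1, b, c)} \<in> edges heis_xyz"
  "{(a, b, c), (a, b + 1, c + a)} \<in> edges heis_xyz"
  "{(a, b, c), (a, b, c + 1)} \<in> edges heis_xyz"
proof -
  show "{(a, b, c), (a + 1, b, c)} \<in> edges heis_xyz"
    "{(a, b, c), (a, b + 1, c + a)} \<in> edges heis_xyz"
    using heis_xy_edgeI heis_xy_edges_subset by blast+
  have "inv\<^bsub>heis_group\<^esub> (a, b, c) \<otimes>\<^bsub>heis_group\<^esub> (a, b, c + 1) = heis_z"
    by (simp add: heis_z_def algebra_simps)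
  then show "{(a, b, c), (a, b, c + 1)} \<in> edges heis_xyz"
    unfolding heis_xyz_def cayley_graph_def graph.simps heis_carrier by blast
qed

lemma heis_xy_edge_cases:
  assumes "{g, h} \<in> edges heis_xy"
  obtains (x) a b c where "g = (a, b, c)" "h = (a + 1, b, c)"
    | (x_inv) a b c where "h = (a, b, c)" "g = (a + 1, b, c)"
    | (y) a b c where "g = (a, b, c)" "h = (a, b + 1, c + a)"
    | (y_inv) a b c where "h = (a, b, c)" "g = (a, b + 1, c + a)"
proof -
  have *: "(\<exists>a b c. p = (a, b, c) \<and> q = (a + 1, b, c)) \<or> (\<exists>a b c. q = (a, b, c) \<and> p = (a + 1, b, c))
      \<or> (\<exists>a b c. p = (a, b, c) \<and> q = (a, b + 1, c + a)) \<or> (\<exists>a b c. q = (a, b, c) \<and> p = (a, b + 1, c + a))"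
    if "inv\<^bsub>heis_group\<^esub> p \<otimes>\<^bsub>heis_group\<^esub> q \<in>
      {heis_x, heis_y} \<union> (\<lambda>s. inv\<^bsub>heis_group\<^esub> s) ` {heis_x, heis_y}" for p q
    using that by (cases p; cases q) (auto simp: heis_x_def heis_y_def algebra_simps)
  from assms obtain p q where "{g, h} = {p, q}" "inv\<^bsub>heis_group\<^esub> p \<otimes>\<^bsub>heis_group\<^esub> q \<in>
      {heis_x, heis_y} \<union> (\<lambda>s. inv\<^bsub>heis_group\<^esub> s) ` {heis_x, heis_y}"
    unfolding heis_xy_def cayley_graph_def graph.simps by blast
  with *[of p q] show ?thesis using that by (auto simp: doubleton_eq_iff)
qed

text \<open>Large enough that, for \<open>i < K\<close>, the offsets \<open>1\<close> and
  \<open>i + 2\<close> are distinct nonzero residues modulo the spacing, and heights below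
  \<open>2 * K\<close> are distinct residues modulo its square.\<close>

definition spacing :: "nat \<Rightarrow> int" where "spacing K = int K + 3"

fun base :: "nat \<Rightarrow> heis \<Rightarrow> nat \<Rightarrow> heis" where
  "base K (a, b, c) i = (spacing K * a, spacing K * b, (spacing K)\<^sup>2 * c + 2 * int i)"

text \<open>Terms such as \<open>N * a * t\<close> come from the group law: a \<open>y\<close>-step
  adds the first coordinate to the third. The column point with parameter \<open>m\<close> is one
  generator step away from the point at distance \<open>j + 2\<close> on a forward line of height
  \<open>m\<close>.\<close>

fun blob :: "nat \<Rightarrow> heis \<Rightarrow> nat \<Rightarrow> heis set" where
  "blob K (a, b, c) i =
    (let N = spacing K; z = N\<^sup>2 * c; j = int i in
      (\<lambda>t. (N * a + t, N * b, z + 2 * j)) ` {0..<N} \<union>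
      (\<lambda>t. (N * a - t, N * b, z + 2 * j + 1)) ` {0..<N} \<union>
      (\<lambda>t. (N * a, N * b + t, z + 2 * j + N * a * t)) ` {0..<N} \<union>
      (\<lambda>t. (N * a, N * b - t, z + 2 * j + 1 - N * a * t)) ` {0..<N} \<union>
      (\<lambda>m. (N * a + j + 2, N * b + 1, z + N * a + j + 2 + m)) ` {0..<2 * int K} \<union>
      (\<lambda>m. (N * a + 1, N * b + j + 2, z + N * a * (j + 2) + m)) ` {0..<2 * int K})"

declare base.simps [simp del] blob.simps [simp del]

section \<open>Disjointness and size of the blobs\<close>

text \<open>
  A left inverse of the blob family. The residues of \<open>a\<close> and \<open>b\<close> modulo \<open>N\<close> tell on which of the six
  pieces a point lies: both nonzero on the columns only, where one of them is \<open>1\<close> and the other is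
  \<open>i + 2\<close>. On the rays the parity of the height separates forward from backward rays, hence whether
  to round down or up; the quantity \<open>c - a b\<close> is constant along \<open>y\<close>-rays and congruent to the height modulo \<open>N\<^sup>2\<close>.
\<close>

definition owner :: "nat \<Rightarrow> heis \<Rightarrow> heis \<times> nat" where
  "owner K p = (case p of (a, b, c) \<Rightarrow> let N = spacing K in
     if b mod N = 0 then
       let h = c mod N\<^sup>2 in
       ((if even h then a div N else - ((- a) div N), b div N, c div N\<^sup>2), nat (h div 2))
     else if a mod N = 0 then
       let h = (c - a * b) mod N\<^sup>2; \<beta> = (if even h then b div N else - ((- b) div N)) in
       ((a div N, \<beta>, (c - a * b) div N\<^sup>2 + a div N * \<beta>), nat (h div 2))
     else if b mod N = 1 then
       ((a div N, b div N, (c - a) div N\<^sup>2), nat (a mod N - 2))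
     else
       ((a div N, b div N, (c - (a - 1) * (b mod N)) div N\<^sup>2), nat (b mod N - 2)))"

lemma div_mod_mult_add:
  fixes N :: int
  assumes "0 \<le> t" "t < N"
  shows "(N * a + t) div N = a" "(N * a + t) mod N = t"
  using assms by auto

text \<open>The first form is the rounding up that \<open>owner\<close> performs on backward rays;
  the second one recognises the start of such a ray.\<close>

lemma div_mod_mult_diff:
  fixes N :: int
  assumes "0 \<le> t" "t < N"
  shows "(t - N * a) div N = - a" "(N * a - t) mod N = 0 \<longleftrightarrow> t = 0"
proof -
  have "t - N * a = N * (- a) + t" by simp
  then show "(t - N * a) div N = - a" using div_mod_mult_add(1)[OF assms] by metis
  have "N dvd N * a - t \<longleftrightarrow> N dvd t" using dvd_diff_right_iff[of N "N * a" t] by simp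
  also have "\<dots> \<longleftrightarrow> t = 0" using assms zdvd_not_zless[of t N] by (cases "t = 0") auto
  finally show "(N * a - t) mod N = 0 \<longleftrightarrow> t = 0" by (simp add: mod_eq_0_iff_dvd)
qed

lemma owner_blob:
  assumes "i < K" "p \<in> blob K g i"
  shows "owner K p = (g, i)"
proof -
  obtain a b c where g: "g = (a, b, c)" by (cases g)
  define N where "N = spacing K"
  have K: "int i + 2 < N" "int K + 3 \<le> N" "3 < N" using assms(1) by (auto simp: N_def spacing_def)
  have "2 * N \<le> N\<^sup>2" using K mult_right_mono[of 2 N N] by (simp add: power2_eq_square)
  then have sq: "2 * int K + 6 \<le> N\<^sup>2" using K by simp
  have z: "(N\<^sup>2 * w + m) div N\<^sup>2 = w" "(N\<^sup>2 * w + m) mod N\<^sup>2 = m"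
    if "0 \<le> m" "m < 2 * int K" for w m
    using that sq by (intro div_mod_mult_add; simp)+
  have ev: "2 * int i < 2 * int K" "2 * int i + 1 < 2 * int K" using assms(1) by auto
  note dm = div_mod_mult_add[of _ N] div_mod_mult_diff[of _ N]
  from assms(2) consider
      (x) t where "0 \<le> t" "t < N" "p = (N * a + t, N * b, N\<^sup>2 * c + 2 * int i)"
    | (x') t where "0 \<le> t" "t < N" "p = (N * a - t, N * b, N\<^sup>2 * c + (2 * int i + 1))"
    | (y) t where "0 \<le> t" "t < N" "p = (N * a, N * b + t, N\<^sup>2 * c + 2 * int i + N * a * t)"
    | (y') t where "0 \<le> t" "t < N" "p = (N * a, N * b - t, N\<^sup>2 * c + (2 * int i + 1) - N * a * t)"
    | (cx) m where "0 \<le> m" "m < 2 * int K"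
        "p = (N * a + (int i + 2), N * b + 1, N\<^sup>2 * c + N * a + int i + 2 + m)"
    | (cy) m where "0 \<le> m" "m < 2 * int K"
        "p = (N * a + 1, N * b + (int i + 2), N\<^sup>2 * c + N * a * (int i + 2) + m)"
    unfolding g blob.simps Let_def N_def[symmetric] by (auto simp: add.assoc)
  then show ?thesis
  proof cases
    case x
    then show ?thesis using K z[of "2 * int i" c] ev
      by (simp add: owner_def N_def[symmetric] Let_def g dm)
  next
    case x'
    then show ?thesis using K z[of "2 * int i + 1" c] ev
      by (simp add: owner_def N_def[symmetric] Let_def g dm)
  next
    case y
    \<comment> \<open>Subtracting the product removes the tilt of the \<open>y\<close>-ray;
      \<open>owner\<close> recovers \<open>c\<close> by adding the product of the two rounded
      coordinates.\<close>
    have *: "N\<^sup>2 * c + 2 * int i + N * a * t - N * a * (N * b + t) = N\<^sup>2 * (c - a * b) + 2 * int i"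
      by (simp add: algebra_simps power2_eq_square)
    show ?thesis
    \<comment> \<open>The start of a \<open>y\<close>-ray also lies on an \<open>x\<close>-ray, so
      the first branch of \<open>owner\<close> applies there.\<close>
    proof (cases "t = 0")
      case True
      then show ?thesis using y K z[of "2 * int i" c] ev
        by (simp add: owner_def N_def[symmetric] Let_def g dm)
    next
      case False
      then show ?thesis using y K z[of "2 * int i" "c - a * b"] ev
        by (simp add: owner_def N_def[symmetric] Let_def g dm *)
    qed
  next
    case y'
    have *: "N\<^sup>2 * c + (2 * int i + 1) - N * a * t - N * a * (N * b - t)
        = N\<^sup>2 * (c - a * b) + (2 * int i + 1)"
      by (simp add: algebra_simps power2_eq_square)
    show ?thesis
    proof (cases "t = 0")
      case True
      then show ?thesis using y' K z[of "2 * int i + 1" c] ev dm(3)[of 0 a]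
        by (simp add: owner_def N_def[symmetric] Let_def g)
    next
      case False
      then show ?thesis using y' K z[of "2 * int i + 1" "c - a * b"] ev
        by (simp add: owner_def N_def[symmetric] Let_def g dm *)
    qed
  next
    case cx
    \<comment> \<open>Subtracting the first coordinate undoes the \<open>y\<close>-step from the
      ray's line to the column.\<close>
    have *: "N\<^sup>2 * c + N * a + int i + 2 + m - (N * a + (int i + 2)) = N\<^sup>2 * c + m" by simp
    show ?thesis using cx K z[of m c] dm(1,2)[of "int i + 2" a] dm(1,2)[of 1 b]
      by (simp only: owner_def N_def[symmetric] Let_def g prod.case *) simp
  next
    case cy
    have *: "N\<^sup>2 * c + N * a * (int i + 2) + m - (N * a + 1 - 1) * (int i + 2) = N\<^sup>2 * c + m" by simp
    show ?thesis using cy K z[of m c] dm(1,2)[of "int i + 2" b] dm(1,2)[of 1 a]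
      by (simp add: owner_def N_def[symmetric] Let_def g *)
  qed
qed

lemma blob_disjoint:
  assumes "i < K" "j < K" "(g, i) \<noteq> (h, j)"
  shows "blob K g i \<inter> blob K h j = {}"
  using assms by (metis disjoint_iff owner_blob)

lemma finite_blob: "finite (blob K g i)"
  by (cases g) (simp add: blob.simps Let_def)

lemma card_blob:
  assumes "i < K"
  shows "card (blob K g i) \<le> 20 * K"
proof -
  obtain a b c where g: "g = (a, b, c)" by (cases g)
  have un: "card (A \<union> B) \<le> m + n" if "card A \<le> m" "card B \<le> n" for A B :: "heis set" and m n
    using card_Un_le[of A B] that by simp
  have im: "card (h ` {0..<n}) \<le> nat n" for h :: "int \<Rightarrow> heis" and n
    using card_image_le[of "{0..<n}" h] by simp
  let ?N = "nat (spacing K)" and ?M = "nat (2 * int K)"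
  have "card (blob K g i) \<le> ?N + ?N + ?N + ?N + ?M + ?M"
    unfolding g blob.simps Let_def by (intro un im)
  \<comment> \<open>Four rays of \<open>K + 3\<close> points and two columns of \<open>2 * K\<close>
    points give \<open>8 * K + 12\<close>, and \<open>K\<close> is positive because
    \<open>i < K\<close>.\<close>
  also have "\<dots> \<le> 20 * K" using assms by (simp add: spacing_def nat_add_distrib)
  finally show ?thesis .
qed

section \<open>Connectivity of a blob\<close>

lemma base_in_blob: "base K g i \<in> blob K g i"
proof -
  obtain a b c where g: "g = (a, b, c)" by (cases g)
  have "base K g i \<in> (\<lambda>t. (spacing K * a + t, spacing K * b, (spacing K)\<^sup>2 * c + 2 * int i)) ` {0..<spacing K}"
    unfolding g by (rule image_eqI[of _ _ 0]) (auto simp: spacing_def base.simps)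
  then show ?thesis unfolding g blob.simps Let_def by blast
qed

text \<open>The forward rays share the base, the backward rays share the point one
  \<open>z\<close>-step above it, and each column hangs on its forward ray. All resulting paths have
  length linear in \<open>K\<close>, and \<open>K \<ge> 1\<close> absorbs the constants into
  \<open>7 * K\<close>.\<close>

lemma reach_base_blob:
  assumes "i < K" "p \<in> blob K g i"
  shows "reach heis_xyz (blob K g i) (7 * K) (base K g i) p"
proof -
  obtain a b c where g: "g = (a, b, c)" by (cases g)
  define N where "N = spacing K"
  define z where "z = N\<^sup>2 * c"
  define j where "j = int i"
  define B where "B = blob K g i"
  have N: "N = int K + 3" by (simp add: N_def spacing_def)
  have j: "0 \<le> j" "j < int K" using assms(1) by (auto simp: j_def)
  define X where "X = (\<lambda>t. (N * a + t, N * b, z + 2 * j))"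
  define X' where "X' = (\<lambda>t. (N * a - t, N * b, z + 2 * j + 1))"
  define Y where "Y = (\<lambda>t. (N * a, N * b + t, z + 2 * j + N * a * t))"
  define Y' where "Y' = (\<lambda>t. (N * a, N * b - t, z + 2 * j + 1 - N * a * t))"
  define CX where "CX = (\<lambda>m. (N * a + j + 2, N * b + 1, z + N * a + j + 2 + m))"
  define CY where "CY = (\<lambda>m. (N * a + 1, N * b + j + 2, z + N * a * (j + 2) + m))"
  note line_defs = X_def X'_def Y_def Y'_def CX_def CY_def
  have B: "B = X ` {0..<N} \<union> X' ` {0..<N} \<union> Y ` {0..<N} \<union> Y' ` {0..<N} \<union>
      CX ` {0..<2 * int K} \<union> CY ` {0..<2 * int K}"
    unfolding B_def g blob.simps Let_def line_defs N_def z_def j_def by (rule refl)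
  have base: "base K g i = X 0" "X 0 = Y 0" "X' 0 = Y' 0"
    by (simp_all add: g base.simps line_defs N_def z_def j_def)
  \<comment> \<open>Along a backward ray the generator leads from parameter \<open>t + 1\<close> to
    \<open>t\<close>, hence the shifted instances.\<close>
  have edge: "{X t, X (t + 1)} \<in> edges heis_xyz" "{X' t, X' (t + 1)} \<in> edges heis_xyz"
    "{Y t, Y (t + 1)} \<in> edges heis_xyz" "{Y' t, Y' (t + 1)} \<in> edges heis_xyz"
    "{CX t, CX (t + 1)} \<in> edges heis_xyz" "{CY t, CY (t + 1)} \<in> edges heis_xyz" for t
    using heis_xyz_edgeI(1)[of "N * a + t" "N * b" "z + 2 * j"]
      heis_xyz_edgeI(1)[of "N * a - t - 1" "N * b" "z + 2 * j + 1"]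
      heis_xyz_edgeI(2)[of "N * a" "N * b + t" "z + 2 * j + N * a * t"]
      heis_xyz_edgeI(2)[of "N * a" "N * b - t - 1" "z + 2 * j + 1 - N * a * t - N * a"]
      heis_xyz_edgeI(3)[of "N * a + j + 2" "N * b + 1" "z + N * a + j + 2 + t"]
      heis_xyz_edgeI(3)[of "N * a + 1" "N * b + j + 2" "z + N * a * (j + 2) + t"]
    by (simp_all add: line_defs algebra_simps insert_commute)
  have seg: "reach heis_xyz B (nat (u - l)) (h l) (h u)"
    if "l \<le> u" "\<And>t. {h t, h (t + 1)} \<in> edges heis_xyz" "\<And>t. l \<le> t \<Longrightarrow> t \<le> u \<Longrightarrow> h t \<in> B" for h l u
    using that by (intro reach_line) auto
  have "{X 0, X' 0} \<in> edges heis_xyz"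
    using heis_xyz_edgeI(3)[of "N * a" "N * b" "z + 2 * j"] by (simp add: line_defs)
  then have "reach heis_xyz B 1 (X 0) (X' 0)"
    using N by (intro reach_edge) (auto simp: B)
  note up = reach_trans[OF this]
  have ray: "reach heis_xyz B (nat t) (h 0) (h t)"
    if "0 \<le> t" "t < N" "h \<in> {X, X', Y, Y'}" for h t
  proof -
    have "\<And>t. {h t, h (t + 1)} \<in> edges heis_xyz" using that(3) edge by blast
    moreover have "h s \<in> B" if "0 \<le> s" "s \<le> t" for s
      using that \<open>t < N\<close> \<open>h \<in> {X, X', Y, Y'}\<close> unfolding B by auto
    ultimately show ?thesis using seg[of 0 t h] that(1) by simp
  qed
  have column: "reach heis_xyz B (nat \<bar>m - l\<bar>) (h l) (h m)"
    if "0 \<le> l" "l < 2 * int K" "0 \<le> m" "m < 2 * int K" "h \<in> {CX, CY}" for h l m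
  proof -
    have e: "\<And>t. {h t, h (t + 1)} \<in> edges heis_xyz" using that(5) edge by blast
    have h: "h s \<in> B" if "0 \<le> s" "s < 2 * int K" for s
      using that \<open>h \<in> {CX, CY}\<close> unfolding B by auto
    show ?thesis
    proof (cases "l \<le> m")
      case True
      then show ?thesis using seg[of l m h] e h that by simp
    next
      case False
      then have "reach heis_xyz B (nat (l - m)) (h m) (h l)"
        using e h that by (intro seg) auto
      then show ?thesis using False by (simp add: reach_sym)
    qed
  qed
  \<comment> \<open>The forward rays run at height \<open>2 * j\<close>, so one generator step
    reaches the column at parameter \<open>2 * j\<close>.\<close>
  have "{X (j + 2), CX (2 * j)} \<in> edges heis_xyz" "{Y (j + 2), CY (2 * j)} \<in> edges heis_xyz"
    using heis_xyz_edgeI(2)[of "N * a + j + 2" "N * b" "z + 2 * j"]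
      heis_xyz_edgeI(1)[of "N * a" "N * b + j + 2" "z + 2 * j + N * a * (j + 2)"]
    by (simp_all add: line_defs algebra_simps)
  moreover have "X (j + 2) \<in> B" "CX (2 * j) \<in> B" "Y (j + 2) \<in> B" "CY (2 * j) \<in> B"
    using N j unfolding B by simp_all
  ultimately have step: "reach heis_xyz B 1 (X (j + 2)) (CX (2 * j))"
    "reach heis_xyz B 1 (Y (j + 2)) (CY (2 * j))"
    by (auto intro!: reach_edge simp del: One_nat_def)
  have "\<exists>n \<le> 7 * K. reach heis_xyz B n (X 0) p"
  proof -
    from assms(2) consider
        (x) t where "0 \<le> t" "t < N" "p = X t" | (x') t where "0 \<le> t" "t < N" "p = X' t"
      | (y) t where "0 \<le> t" "t < N" "p = Y t" | (y') t where "0 \<le> t" "t < N" "p = Y' t"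
      | (cx) m where "0 \<le> m" "m < 2 * int K" "p = CX m"
      | (cy) m where "0 \<le> m" "m < 2 * int K" "p = CY m"
      unfolding B_def[symmetric] B by auto
    then show ?thesis
    proof cases
      case x
      then have "reach heis_xyz B (nat t) (X 0) p" using ray[of t X] by simp
      moreover have "nat t \<le> 7 * K" using x N j by simp
      ultimately show ?thesis by blast
    next
      case x'
      then have "reach heis_xyz B (1 + nat t) (X 0) p" using ray[of t X'] up by simp
      moreover have "1 + nat t \<le> 7 * K" using x' N j by simp
      ultimately show ?thesis by blast
    next
      case y
      then have "reach heis_xyz B (nat t) (X 0) p" using ray[of t Y] base by simp
      moreover have "nat t \<le> 7 * K" using y N j by simp
      ultimately show ?thesis by blast
    next
      case y'
      then have "reach heis_xyz B (1 + nat t) (X 0) p" using ray[of t Y'] base up by simp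
      moreover have "1 + nat t \<le> 7 * K" using y' N j by simp
      ultimately show ?thesis by blast
    next
      case cx
      then have "reach heis_xyz B (nat (j + 2) + 1 + nat \<bar>m - 2 * j\<bar>) (X 0) p"
        using reach_trans[OF reach_trans[OF ray[of "j + 2" X] step(1)] column[of "2 * j" m CX]] j N
        by simp
      moreover have "nat (j + 2) + 1 + nat \<bar>m - 2 * j\<bar> \<le> 7 * K" using cx N j by arith
      ultimately show ?thesis by blast
    next
      case cy
      then have "reach heis_xyz B (nat (j + 2) + 1 + nat \<bar>m - 2 * j\<bar>) (X 0) p"
        using reach_trans[OF reach_trans[OF ray[of "j + 2" Y] step(2)] column[of "2 * j" m CY]] j N base
        by simp
      moreover have "nat (j + 2) + 1 + nat \<bar>m - 2 * j\<bar> \<le> 7 * K" using cy N j by arith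
      ultimately show ?thesis by blast
    qed
  qed
  then obtain n where "n \<le> 7 * K" "reach heis_xyz B n (X 0) p" by (elim exE conjE)
  then show ?thesis unfolding B_def[symmetric] base(1) by (intro reach_mono[of _ B n _ _ B "7 * K"] order_refl)
qed

section \<open>Contact between blobs at neighbouring elements\<close>

text \<open>The column of the first blob meets the backward ray of the second one at height \<open>2j + 1\<close>.\<close>

lemma blob_adjacent_step:
  assumes "i < K" "j < K"
  shows "\<exists>p \<in> blob K (a, b, c) i. \<exists>q \<in> blob K (a + 1, b, c) j. {p, q} \<in> edges heis_xyz"
    and "\<exists>p \<in> blob K (a, b, c) i. \<exists>q \<in> blob K (a, b + 1, c + a) j. {p, q} \<in> edges heis_xyz"
proof -
  define N where "N = spacing K"
  let ?i = "int i" and ?j = "int j"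
  have N: "?i + 2 < N" using assms(1) by (simp add: N_def spacing_def)
  have "(N * a + ?i + 2, N * b + 1, N\<^sup>2 * c + N * a + ?i + 2 + (2 * ?j + 1)) \<in> blob K (a, b, c) i"
    unfolding blob.simps Let_def N_def[symmetric]
    by (rule UnI1, rule UnI2, rule image_eqI[of _ _ "2 * ?j + 1"]) (use assms in auto)
  \<comment> \<open>Counting back \<open>N - ?i - 2\<close> from the next dilated point leads to
    first coordinate \<open>N * a + ?i + 2\<close>, right beside the column.\<close>
  moreover have "(N * (a + 1) - (N - ?i - 2), N * b, N\<^sup>2 * c + 2 * ?j + 1) \<in> blob K (a + 1, b, c) j"
    unfolding blob.simps Let_def N_def[symmetric]
    by (rule UnI1, rule UnI1, rule UnI1, rule UnI1, rule UnI2,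
        rule image_eqI[of _ _ "N - ?i - 2"]) (use N in auto)
  moreover have "{(N * a + ?i + 2, N * b + 1, N\<^sup>2 * c + N * a + ?i + 2 + (2 * ?j + 1)),
      (N * (a + 1) - (N - ?i - 2), N * b, N\<^sup>2 * c + 2 * ?j + 1)} \<in> edges heis_xyz"
    using heis_xyz_edgeI(2)[of "N * a + ?i + 2" "N * b" "N\<^sup>2 * c + 2 * ?j + 1"]
    by (simp add: algebra_simps insert_commute)
  ultimately show "\<exists>p \<in> blob K (a, b, c) i. \<exists>q \<in> blob K (a + 1, b, c) j. {p, q} \<in> edges heis_xyz"
    by blast
  have "(N * a + 1, N * b + ?i + 2, N\<^sup>2 * c + N * a * (?i + 2) + (2 * ?j + 1)) \<in> blob K (a, b, c) i"
    unfolding blob.simps Let_def N_def[symmetric]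
    by (rule UnI2, rule image_eqI[of _ _ "2 * ?j + 1"]) (use assms in auto)
  \<comment> \<open>The terms with \<open>N\<^sup>2 * a\<close> cancel, leaving height
    \<open>N\<^sup>2 * c + N * a * (?i + 2) + 2 * ?j + 1\<close>, that of the column point.\<close>
  moreover have "(N * a, N * (b + 1) - (N - ?i - 2), N\<^sup>2 * (c + a) + 2 * ?j + 1 - N * a * (N - ?i - 2))
      \<in> blob K (a, b + 1, c + a) j"
    unfolding blob.simps Let_def N_def[symmetric]
    by (rule UnI1, rule UnI1, rule UnI2, rule image_eqI[of _ _ "N - ?i - 2"]) (use N in auto)
  moreover have "{(N * a + 1, N * b + ?i + 2, N\<^sup>2 * c + N * a * (?i + 2) + (2 * ?j + 1)),
      (N * a, N * (b + 1) - (N - ?i - 2), N\<^sup>2 * (c + a) + 2 * ?j + 1 - N * a * (N - ?i - 2))}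
      \<in> edges heis_xyz"
    using heis_xyz_edgeI(1)[of "N * a" "N * b + ?i + 2" "N\<^sup>2 * c + N * a * (?i + 2) + (2 * ?j + 1)"]
    by (simp add: algebra_simps power2_eq_square insert_commute)
  ultimately show "\<exists>p \<in> blob K (a, b, c) i. \<exists>q \<in> blob K (a, b + 1, c + a) j. {p, q} \<in> edges heis_xyz"
    by blast
qed

lemma blob_adjacent:
  assumes "{g, h} \<in> edges heis_xy" "i < K" "j < K"
  shows "\<exists>p \<in> blob K g i. \<exists>q \<in> blob K h j. {p, q} \<in> edges heis_xyz"
proof -
  have flip: "\<exists>q \<in> B. \<exists>p \<in> A. {q, p} \<in> E" if *: "\<exists>p \<in> A. \<exists>q \<in> B. {p, q} \<in> E"
    for A B :: "heis set" and E
  proof -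
    from * obtain p q where "p \<in> A" "q \<in> B" "{q, p} \<in> E" by (auto simp: insert_commute)
    then show ?thesis by blast
  qed
  show ?thesis
    using assms(1)
  proof (cases rule: heis_xy_edge_cases)
    case (x a b c)
    then show ?thesis using blob_adjacent_step(1)[OF assms(2,3)] by simp
  next
    case (x_inv a b c)
    show ?thesis unfolding x_inv by (rule flip[OF blob_adjacent_step(1)[OF assms(3,2)]])
  next
    case (y a b c)
    then show ?thesis using blob_adjacent_step(2)[OF assms(2,3)] by simp
  next
    case (y_inv a b c)
    show ?thesis unfolding y_inv by (rule flip[OF blob_adjacent_step(2)[OF assms(3,2)]])
  qed
qed

section \<open>Walks through chains of blobs\<close>

lemma reach_base_base:
  assumes "{g, h} \<in> edges heis_xy" "i < K" "j < K"
  shows "reach heis_xyz (blob K g i \<union> blob K h j) (15 * K) (base K g i) (base K h j)"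
proof -
  let ?A = "blob K g i \<union> blob K h j"
  obtain p q where pq: "p \<in> blob K g i" "q \<in> blob K h j" "{p, q} \<in> edges heis_xyz"
    using blob_adjacent[OF assms] by blast
  have 1: "reach heis_xyz ?A (7 * K) (base K g i) p"
    using reach_mono[OF reach_base_blob] assms pq by simp
  have 2: "reach heis_xyz ?A 1 p q" using pq by (intro reach_edge) auto
  have 3: "reach heis_xyz ?A (7 * K) q (base K h j)"
    using reach_mono[OF reach_sym[OF reach_base_blob]] assms pq by simp
  show ?thesis
    by (rule reach_mono[OF reach_trans[OF reach_trans[OF 1 2] 3]]) (use assms in auto)
qed

text \<open>Blobs at adjacent elements touch whatever their numbers are. Numbers belong to
  positions, not to elements, since a road may return to the image of its end, once with a vertex
  blob and once with an edge blob.\<close>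

lemma reach_base_chain:
  assumes "walk heis_xy (map fst ps)" "\<forall>(g, i) \<in> set ps. i < K"
  shows "reach heis_xyz (\<Union>(g, i) \<in> set ps. blob K g i) (15 * K * (length ps - 1))
    (case_prod (base K) (hd ps)) (case_prod (base K) (last ps))"
  using assms
proof (induction ps rule: induct_list012)
  case 1
  then show ?case by (simp add: walk_def)
next
  case (2 p)
  then show ?case using base_in_blob by (cases p) (auto intro!: reach_refl)
next
  case (3 p q ps)
  obtain g i h j where p: "p = (g, i)" and q: "q = (h, j)" by (cases p, cases q)
  let ?U = "\<Union>(g, i) \<in> set (p # q # ps). blob K g i"
  have 1: "reach heis_xyz ?U (15 * K) (base K g i) (base K h j)"
    by (rule reach_mono[OF reach_base_base]) (use 3(3,4) in \<open>auto simp: p q walk_def\<close>)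
  have 2: "reach heis_xyz ?U (15 * K * (length (q # ps) - 1))
      (base K h j) (case_prod (base K) (last (q # ps)))"
  proof -
    have "reach heis_xyz (\<Union>(g, i) \<in> set (q # ps). blob K g i) (15 * K * (length (q # ps) - 1))
      (case_prod (base K) (hd (q # ps))) (case_prod (base K) (last (q # ps)))"
      using 3(3,4) by (intro 3(2)) (auto simp: walk_def)
    then have "reach heis_xyz (\<Union>(g, i) \<in> set (q # ps). blob K g i) (15 * K * (length (q # ps) - 1))
      (base K h j) (case_prod (base K) (last (q # ps)))" by (simp add: q)
    then show ?thesis by (rule reach_mono) auto
  qed
  show ?case using reach_trans[OF 1 2] by (simp add: p algebra_simps)
qed

lemma length_ge_2_cases:
  assumes "length w \<ge> 2"
  obtains u v w' where "w = u # w' @ [v]"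
proof -
  obtain u w1 where "w = u # w1" using assms by (cases w) auto
  moreover from this have "w1 \<noteq> []" using assms by auto
  ultimately have "w = u # butlast w1 @ [last w1]" by simp
  then show ?thesis by (rule that)
qed

text \<open>At most \<open>2 * D\<close> steps at cost \<open>15 * K\<close>, plus
  \<open>7 * K\<close> at either end, make at most \<open>44 * K * D\<close> because
  \<open>D \<ge> 1\<close>.\<close>

lemma graph_dist_blob_le:
  assumes "p \<in> blob K g i" "q \<in> blob K h j" "i < K" "j < K"
    and "graph_dist heis_xy g h \<le> D" "D > 0"
  shows "graph_dist heis_xyz p q \<le> 44 * K * D"
proof -
  \<comment> \<open>At least one step is needed, since chains pass only between adjacent elements
    and \<open>i\<close>, \<open>j\<close> may differ even if \<open>g = h\<close>. In that case the
    walk visits a neighbour and returns; these two steps fit into \<open>2 * D\<close>.\<close>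
  have "\<exists>w. walk heis_xy w \<and> hd w = g \<and> last w = h \<and> length w \<ge> 2 \<and> length w \<le> Suc (2 * D)"
  proof -
    obtain w where w: "walk heis_xy w" "hd w = g" "last w = h" "length w = Suc (graph_dist heis_xy g h)"
      using graph_dist_walk heis_xy_connected by metis
    show ?thesis
    proof (cases "graph_dist heis_xy g h = 0")
      case False
      then show ?thesis using w assms(5) by (intro exI[of _ w]) simp
    next
      case True
      then have "g = h" using w by (cases w) auto
      obtain a b c where g: "g = (a, b, c)" by (cases g)
      show ?thesis using \<open>g = h\<close> heis_xy_edgeI(1)[of a b c] assms(6) unfolding g
        by (intro exI[of _ "[(a, b, c), (a + 1, b, c), (a, b, c)]"]) (simp add: walk_def insert_commute)
    qed
  qed
  then obtain w where w: "walk heis_xy w" "hd w = g" "last w = h" "length w \<ge> 2" "length w \<le> Suc (2 * D)"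
    by blast
  obtain w' where w': "w = g # w' @ [h]" using length_ge_2_cases[OF w(4)] w(2,3) by fastforce
  define ps where "ps = (g, i) # map (\<lambda>v. (v, 0)) w' @ [(h, j)]"
  have "map fst ps = w" by (simp add: ps_def w' comp_def)
  moreover have "\<forall>(g, i) \<in> set ps. i < K" using assms(3,4) by (auto simp: ps_def)
  ultimately have "reach heis_xyz (\<Union>(g, i) \<in> set ps. blob K g i) (15 * K * (length ps - 1))
    (case_prod (base K) (hd ps)) (case_prod (base K) (last ps))"
    using w(1) by (intro reach_base_chain) auto
  then have "reach heis_xyz UNIV (15 * K * (length ps - 1)) (base K g i) (base K h j)"
    using reach_mono[of _ "\<Union>(g, i) \<in> set ps. blob K g i" _ _ _ UNIV] by (simp add: ps_def)
  moreover have "length ps - 1 \<le> 2 * D" using w(5) by (simp add: ps_def w')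
  then have "15 * K * (length ps - 1) \<le> 15 * K * (2 * D)" by (rule mult_left_mono) simp
  ultimately have base_base: "reach heis_xyz UNIV (15 * K * (2 * D)) (base K g i) (base K h j)"
    by (rule reach_mono[OF _ order_refl])
  note to_blob = reach_mono[OF reach_base_blob subset_UNIV order_refl]
  have "reach heis_xyz UNIV (7 * K + 15 * K * (2 * D) + 7 * K) p q"
    using reach_trans[OF reach_trans[OF reach_sym[OF to_blob] base_base] to_blob] assms(1-4) by metis
  then have "graph_dist heis_xyz p q \<le> 7 * K + 15 * K * (2 * D) + 7 * K"
    by (rule reach_imp_graph_dist_le)
  also have "\<dots> \<le> 44 * K * D"
    using assms(6) by (cases D) (auto simp: algebra_simps)
  finally show ?thesis .
qed

section \<open>The embedding\<close>

text \<open>Used to number the edges whose roads meet \<open>y\<close>, and likewise the vertices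
  mapped to \<open>y\<close>, so that each gets its own blob there.\<close>

lemma inj_on_lessThan_family:
  assumes "\<And>y. finite (A y)" "\<And>y. card (A y) \<le> k"
  shows "\<exists>s. \<forall>y. inj_on (s y) (A y) \<and> s y ` A y \<subseteq> {..<k}"
proof (intro choice allI)
  show "\<exists>f. inj_on f (A y) \<and> f ` A y \<subseteq> {..<k}" for y
    using card_le_inj[of "A y" "{..<k}"] assms by auto
qed

text \<open>Natural numbers as vertices cover all finite graphs up to isomorphism. The guard on the
  diameter bound excludes a degenerate case: if several isolated vertices all go to one point, the
  old diameter is zero while injectivity makes the new one positive.\<close>

theorem proposition1p2:
  shows "\<exists>C::real. \<forall>(G :: nat graph) (k :: nat) (f :: (nat, heis) wiring).
    simple_graph G \<longrightarrow> finite (verts G) \<longrightarrow>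
    combinatorial_k_wiring k G heis_xy f \<longrightarrow>
    (\<forall>u v. {u, v} \<in> edges G \<longrightarrow> vmap f u \<noteq> vmap f v) \<longrightarrow>
    (\<exists>f' :: (nat, heis) wiring.
       combinatorial_embedding G heis_xyz f' \<and>
       (card (verts G) \<le> 1 \<or> 0 < wiring_diam G heis_xy f \<longrightarrow>
          real (wiring_diam G heis_xyz f') \<le> C * real k * real (wiring_diam G heis_xy f)) \<and>
       real (wiring_vol G f') \<le> C * real k ^ 2 * real (wiring_vol G f))"
\<comment> \<open>One constant serves both bounds: the diameter costs
  \<open>44 * K = 88 * k\<close>, the volume \<open>20 * K * K = 80 * k ^ 2\<close>.\<close>
proof (intro exI[of _ 88] allI impI)
  fix G :: "nat graph" and k :: nat and f :: "(nat, heis) wiring"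
  assume simple: "simple_graph G" and fin: "finite (verts G)"
    and wiring: "combinatorial_k_wiring k G heis_xy f"
    and ne: "\<forall>u v. {u, v} \<in> edges G \<longrightarrow> vmap f u \<noteq> vmap f v"
  have fin_edges: "finite (edges G)"
    using simple fin unfolding simple_graph_def
    by (intro finite_subset[of "edges G" "Pow (verts G)"]) auto
  have load: "card {e \<in> edges G. y \<in> set (road f e)} \<le> k" "card {v \<in> verts G. vmap f v = y} \<le> k" for y
    using wiring unfolding combinatorial_k_wiring_def load_def by (simp_all del: split_paired_All)
  have fin_load: "finite {e \<in> edges G. y \<in> set (road f e)}" "finite {v \<in> verts G. vmap f v = y}" for y
    using fin fin_edges by simp_all
  obtain s where "\<forall>y. inj_on (s y) {e \<in> edges G. y \<in> set (road f e)} \<and>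
      s y ` {e \<in> edges G. y \<in> set (road f e)} \<subseteq> {..<k}"
    using inj_on_lessThan_family[where A = "\<lambda>y. {e \<in> edges G. y \<in> set (road f e)}",
      OF fin_load(1) load(1)] by (rule exE)
  then have s: "inj_on (s y) {e \<in> edges G. y \<in> set (road f e)}"
      "s y ` {e \<in> edges G. y \<in> set (road f e)} \<subseteq> {..<k}" for y
    by blast+
  obtain r where "\<forall>y. inj_on (r y) {v \<in> verts G. vmap f v = y} \<and>
      r y ` {v \<in> verts G. vmap f v = y} \<subseteq> {..<k}"
    using inj_on_lessThan_family[where A = "\<lambda>y. {v \<in> verts G. vmap f v = y}",
      OF fin_load(2) load(2)] by (rule exE)
  then have r: "inj_on (r y) {v \<in> verts G. vmap f v = y}"
      "r y ` {v \<in> verts G. vmap f v = y} \<subseteq> {..<k}" for y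
    by blast+
  define K where "K = 2 * k"
  \<comment> \<open>Vertices take numbers from \<open>k\<close> on, edges those below
    \<open>k\<close>, so a vertex and an edge never share a blob.\<close>
  define slot where "slot v = (vmap f v, k + r (vmap f v) v)" for v
  define V where "V v = case_prod (blob K) (slot v)" for v
  define \<phi> where "\<phi> v = case_prod (base K) (slot v)" for v
  \<comment> \<open>Disjointness is checked on these regions, so any walk inside \<open>U e\<close>
    with the right ends can serve as new road.\<close>
  define U where "U e = (\<Union>v \<in> e. V v) \<union> (\<Union>h \<in> set (road f e). blob K h (s h e))" for e
  have sE: "s h e < k" if "e \<in> edges G" "h \<in> set (road f e)" for e h
    using s(2)[of h] that by auto
  have rV: "r (vmap f v) v < k" if "v \<in> verts G" for v using r(2)[of "vmap f v"] that by auto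
  have \<phi>V: "\<phi> v \<in> V v" for v by (simp add: \<phi>_def V_def slot_def base_in_blob)
  have edge_verts: "e \<subseteq> verts G" if "e \<in> edges G" for e
    using simple that by (auto simp: simple_graph_def)
  have disjVV: "V u \<inter> V v = {}" if "u \<in> verts G" "v \<in> verts G" "u \<noteq> v" for u v
  proof -
    have "slot u \<noteq> slot v" using that r(1)[of "vmap f u"] by (auto simp: slot_def inj_on_def)
    then show ?thesis using that rV[of u] rV[of v]
      unfolding V_def slot_def prod.case K_def by (intro blob_disjoint) auto
  qed
  have disjVE: "V v \<inter> blob K h (s h e) = {}" if "v \<in> verts G" "e \<in> edges G" "h \<in> set (road f e)" for v e h
    using that rV[of v] sE[of e h] unfolding V_def slot_def prod.case K_def
    by (intro blob_disjoint) auto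
  have disjEE: "blob K h (s h e) \<inter> blob K h' (s h' t) = {}"
    if "e \<in> edges G" "t \<in> edges G" "h \<in> set (road f e)" "h' \<in> set (road f t)" "e \<noteq> t" for e t h h'
  proof -
    have "(h, s h e) \<noteq> (h', s h' t)" using that s(1)[of h] by (auto simp: inj_on_def)
    then show ?thesis using that sE[of e h] sE[of t h'] unfolding K_def
      by (intro blob_disjoint) auto
  qed

  \<comment> \<open>The new road inside its region\<close>
  have "\<exists>w. walk heis_xyz w \<and> set w \<subseteq> U e \<and> {hd w, last w} = \<phi> ` e" if e: "e \<in> edges G" for e
  proof -
    have w: "walk heis_xy (road f e)" "{hd (road f e), last (road f e)} = vmap f ` e"
      using wiring e unfolding combinatorial_k_wiring_def combinatorial_wiring_def by auto
    \<comment> \<open>The wiring fixes the ends of a road only as a set; \<open>u\<close> and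
      \<open>v\<close> get named in the order of the road.\<close>
    obtain a b where "e = {a, b}" "a \<noteq> b"
      using simple e by (auto simp: simple_graph_def card_2_iff)
    then obtain u v where uv: "e = {u, v}" "hd (road f e) = vmap f u" "last (road f e) = vmap f v"
      using w(2) by (auto simp: doubleton_eq_iff)
    have "vmap f u \<noteq> vmap f v" using ne e uv(1) by blast
    then have len: "length (road f e) \<ge> 2"
      using uv w(1) by (cases "road f e" rule: remdups_adj.cases) (auto simp: walk_def)
    then obtain w' where w': "road f e = vmap f u # w' @ [vmap f v]"
      using length_ge_2_cases[OF len] uv(2,3) by fastforce
    \<comment> \<open>Only the two extreme positions carry vertex blobs; returns to the images of
      the ends use the blob of the edge.\<close>
    define ps where "ps = slot u # map (\<lambda>h. (h, s h e)) w' @ [slot v]"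
    have "map fst ps = road f e" by (simp add: ps_def w' comp_def slot_def)
    moreover have "\<forall>(g, i) \<in> set ps. i < K"
    proof -
      have "u \<in> verts G" "v \<in> verts G" using edge_verts[OF e] uv(1) by auto
      then have "k + r (vmap f u) u < K" "k + r (vmap f v) v < K" using rV by (simp_all add: K_def)
      moreover have "s h e < K" if "h \<in> set w'" for h
        using sE[OF e, of h] that by (simp add: K_def w')
      ultimately show ?thesis by (auto simp: ps_def slot_def simp del: split_paired_All)
    qed
    ultimately have "reach heis_xyz (\<Union>(g, i) \<in> set ps. blob K g i) (15 * K * (length ps - 1))
        (case_prod (base K) (hd ps)) (case_prod (base K) (last ps))"
      using w(1) by (intro reach_base_chain) auto
    moreover have "(\<Union>(g, i) \<in> set ps. blob K g i) \<subseteq> U e"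
    proof -
      have "V u \<subseteq> U e" "V v \<subseteq> U e" unfolding U_def by (auto simp: uv(1))
      moreover have "(\<Union>h \<in> set w'. blob K h (s h e)) \<subseteq> U e"
        unfolding U_def w' by (intro le_supI2 UN_mono) auto
      moreover have "(\<Union>(g, i) \<in> set ps. blob K g i) = V u \<union> V v \<union> (\<Union>h \<in> set w'. blob K h (s h e))"
        by (simp add: ps_def V_def Un_ac)
      ultimately show ?thesis by simp
    qed
    ultimately have "reach heis_xyz (U e) (15 * K * (length ps - 1))
        (case_prod (base K) (hd ps)) (case_prod (base K) (last ps))"
      by (rule reach_mono[OF _ _ order_refl])
    moreover have "case_prod (base K) (hd ps) = \<phi> u" "case_prod (base K) (last ps) = \<phi> v"
      by (simp_all add: ps_def \<phi>_def)
    ultimately show ?thesis unfolding reach_def uv(1) by auto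
  qed
  then have "\<forall>e \<in> edges G. \<exists>w. walk heis_xyz w \<and> set w \<subseteq> U e \<and> {hd w, last w} = \<phi> ` e" by blast
  from bchoice[OF this] obtain R where R: "\<And>e. e \<in> edges G \<Longrightarrow> walk heis_xyz (R e)"
      "\<And>e. e \<in> edges G \<Longrightarrow> set (R e) \<subseteq> U e"
      "\<And>e. e \<in> edges G \<Longrightarrow> {hd (R e), last (R e)} = \<phi> ` e"
    by blast
  define f' where "f' = \<lparr>vmap = \<phi>, road = R\<rparr>"
  have f'[simp]: "vmap f' = \<phi>" "road f' = R" by (simp_all add: f'_def)

  \<comment> \<open>The embedding conditions\<close>
  have emb: "combinatorial_embedding G heis_xyz f'"
    unfolding combinatorial_embedding_def combinatorial_wiring_def f'
  proof (intro conjI ballI impI)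
    show "inj_on \<phi> (verts G)" using disjVV \<phi>V by (intro inj_onI) (metis disjoint_iff)
  next
    fix e t assume et: "e \<in> edges G" "t \<in> edges G" "e \<inter> t = {}"
    have "e \<noteq> {}" using simple et(1) by (auto simp: simple_graph_def)
    then have "e \<noteq> t" using et(3) by auto
    have "x \<notin> U t" if "x \<in> U e" for x
    proof
      assume "x \<in> U t"
      with \<open>x \<in> U e\<close> consider
          (VV) u v where "u \<in> e" "v \<in> t" "x \<in> V u \<inter> V v"
        | (VE) u h where "u \<in> e" "h \<in> set (road f t)" "x \<in> V u \<inter> blob K h (s h t)"
        | (EV) v h where "v \<in> t" "h \<in> set (road f e)" "x \<in> V v \<inter> blob K h (s h e)"
        | (EE) h h' where "h \<in> set (road f e)" "h' \<in> set (road f t)"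
            "x \<in> blob K h (s h e) \<inter> blob K h' (s h' t)"
        unfolding U_def by blast
      then show False
      proof cases
        case VV
        moreover from this have "u \<noteq> v" using et(3) by auto
        ultimately show False using disjVV[of u v] edge_verts[OF et(1)] edge_verts[OF et(2)] by auto
      next
        case VE
        then show False using disjVE[of u t h] edge_verts[OF et(1)] et(2) by auto
      next
        case EV
        then show False using disjVE[of v e h] edge_verts[OF et(2)] et(1) by auto
      next
        case EE
        then show False using disjEE[of e t h h'] et(1,2) \<open>e \<noteq> t\<close> by auto
      qed
    qed
    then show "set (R e) \<inter> set (R t) = {}" using R(2) et by blast
  next
    fix e v assume ev: "e \<in> edges G" "v \<in> verts G" "v \<notin> e"
    have "\<phi> v \<notin> V u" if "u \<in> e" for u
    proof -
      have "u \<in> verts G" "u \<noteq> v" using edge_verts[OF ev(1)] that ev(3) by auto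
      then show ?thesis using disjVV[of u v] ev(2) \<phi>V[of v] by auto
    qed
    moreover have "\<phi> v \<notin> blob K h (s h e)" if "h \<in> set (road f e)" for h
      using disjVE[OF ev(2,1) that] \<phi>V[of v] by auto
    ultimately have "\<phi> v \<notin> U e" unfolding U_def by blast
    then show "\<phi> v \<notin> set (R e)" using R(2) ev by blast
  qed (use R in auto)

  \<comment> \<open>Diameter and volume\<close>
  let ?I = "wiring_image G f" and ?I' = "wiring_image G f'"
  have finI: "finite ?I" using fin fin_edges by (simp add: wiring_image_def)
  have V_sub: "V v \<subseteq> (\<Union>h \<in> ?I. \<Union>i < K. blob K h i)" if "v \<in> verts G" for v
    using rV[OF that] that unfolding V_def slot_def K_def wiring_image_def by fastforce
  have U_sub: "U e \<subseteq> (\<Union>h \<in> ?I. \<Union>i < K. blob K h i)" if "e \<in> edges G" for e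
  proof -
    have "blob K h (s h e) \<subseteq> (\<Union>h \<in> ?I. \<Union>i < K. blob K h i)" if "h \<in> set (road f e)" for h
      using sE[OF \<open>e \<in> edges G\<close> that] that \<open>e \<in> edges G\<close> unfolding K_def wiring_image_def by fastforce
    then show ?thesis using V_sub edge_verts[OF that] unfolding U_def by blast
  qed
  have sub: "?I' \<subseteq> (\<Union>h \<in> ?I. \<Union>i < K. blob K h i)"
  proof -
    have "\<phi> ` verts G \<subseteq> (\<Union>h \<in> ?I. \<Union>i < K. blob K h i)"
      using \<phi>V V_sub by (intro image_subsetI) (rule subsetD)
    moreover have "(\<Union>e \<in> edges G. set (R e)) \<subseteq> (\<Union>h \<in> ?I. \<Union>i < K. blob K h i)"
      by (intro UN_least order_trans[OF R(2) U_sub])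
    ultimately show ?thesis unfolding wiring_image_def[of G f'] f' by (rule Un_least)
  qed
  have diam: "wiring_diam G heis_xyz f' \<le> 88 * k * wiring_diam G heis_xy f"
    if "card (verts G) \<le> 1 \<or> 0 < wiring_diam G heis_xy f"
  proof (cases "0 < wiring_diam G heis_xy f")
    case True
    show ?thesis unfolding wiring_diam_def[of G heis_xyz]
    proof (rule graph_diam_le)
      fix p q assume "p \<in> ?I'" "q \<in> ?I'"
      then obtain g i h j where "g \<in> ?I" "h \<in> ?I" "i < K" "j < K" "p \<in> blob K g i" "q \<in> blob K h j"
        using sub by blast
      then have "graph_dist heis_xyz p q \<le> 44 * K * wiring_diam G heis_xy f"
        using graph_dist_blob_le graph_dist_le_diam[OF finI, of g h] True
        unfolding wiring_diam_def by metis
      then show "graph_dist heis_xyz p q \<le> 88 * k * wiring_diam G heis_xy f" by (simp add: K_def)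
    qed
  next
    case False
    \<comment> \<open>At most one vertex means no edges, so the new image has at most one point and
      diameter zero.\<close>
    then have card1: "card (verts G) \<le> 1" using that by simp
    have "e \<notin> edges G" for e
    proof
      assume "e \<in> edges G"
      then have "card e = 2" "card e \<le> card (verts G)"
        using simple card_mono[OF fin edge_verts] by (auto simp: simple_graph_def)
      then show False using card1 by simp
    qed
    then have "?I' = \<phi> ` verts G" by (auto simp: wiring_image_def)
    then have "p = q" if "p \<in> ?I'" "q \<in> ?I'" for p q
      using that card1 fin by (auto simp: card_le_Suc0_iff_eq)
    moreover have "graph_dist heis_xyz p p = 0" for p
      using reach_imp_graph_dist_le[OF reach_refl[of p heis_xyz UNIV]] by simp
    ultimately have "wiring_diam G heis_xyz f' \<le> 0"
      unfolding wiring_diam_def by (intro graph_diam_le) (metis order_refl)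
    then show ?thesis by simp
  qed
  \<comment> \<open>Each point of the old image carries \<open>K\<close> blobs of at most
    \<open>20 * K\<close> points, and these cover the new image.\<close>
  have "wiring_vol G f' \<le> card (\<Union>h \<in> ?I. \<Union>i < K. blob K h i)"
    unfolding wiring_vol_def using sub finI by (intro card_mono) (auto simp: finite_blob)
  also have "\<dots> \<le> (\<Sum>h \<in> ?I. card (\<Union>i < K. blob K h i))" by (rule card_UN_le[OF finI])
  also have "\<dots> \<le> (\<Sum>h \<in> ?I. K * (20 * K))"
  proof (rule sum_mono)
    fix h
    have "card (\<Union>i < K. blob K h i) \<le> (\<Sum>i < K. card (blob K h i))" by (rule card_UN_le) simp
    also have "\<dots> \<le> (\<Sum>i < K. 20 * K)" by (rule sum_mono) (simp add: card_blob)
    finally show "card (\<Union>i < K. blob K h i) \<le> K * (20 * K)" by simp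
  qed
  also have "\<dots> = 80 * k ^ 2 * wiring_vol G f"
    by (simp add: K_def wiring_vol_def power2_eq_square)
  also have "\<dots> \<le> 88 * k ^ 2 * wiring_vol G f" by simp
  finally have vol: "wiring_vol G f' \<le> 88 * k ^ 2 * wiring_vol G f" .
  show "\<exists>f' :: (nat, heis) wiring.
       combinatorial_embedding G heis_xyz f' \<and>
       (card (verts G) \<le> 1 \<or> 0 < wiring_diam G heis_xy f \<longrightarrow>
          real (wiring_diam G heis_xyz f') \<le> 88 * real k * real (wiring_diam G heis_xy f)) \<and>
       real (wiring_vol G f') \<le> 88 * real k ^ 2 * real (wiring_vol G f)"
  proof (intro exI[of _ f'] conjI impI)
    show "real (wiring_diam G heis_xyz f') \<le> 88 * real k * real (wiring_diam G heis_xy f)"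
      if "card (verts G) \<le> 1 \<or> 0 < wiring_diam G heis_xy f"
      using of_nat_mono[OF diam[OF that], where 'a = real] by simp
    show "real (wiring_vol G f') \<le> 88 * real k ^ 2 * real (wiring_vol G f)"
      using of_nat_mono[OF vol, where 'a = real] by simp
  qed (rule emb)
qed

end
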